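(* For any $a>0$, $\sigma>0$ and any integers $n,p,s\ge 1$ with $s<p$, and for every $s'\in(0,s]$, $$\inf_{\tilde\eta}\ \sup_{\beta\in\Omega^p_{s,a}}\mathbf{E}_\beta|\tilde\eta-\eta_\beta|\ \ge\ \frac{s'}{s}\Big(\psi_+(n,p,s,a,\sigma)-4s\,e^{-\frac{(s-s')^2}{2s}}\Big),$$ where the infimum is over all selectors $\tilde\eta$.
   Context: Model: $Y=X\beta+\sigma\xi\in\mathbb{R}^n$, where $X\in\mathbb{R}^{n\times p}$ has i.i.d. $\mathcal N(0,1)$ entries, $\xi\sim\mathcal N(0,\mathbb I_n)$ is independent of $X$, $\beta\in\mathbb{R}^p$ unknown, $\sigma>0$. $\mathbf P_\beta,\mathbf E_\beta$ denote the joint law of $(X,Y)$ and its expectation. For $a>0$ and integer $s\le p$, $\Omega^p_{s,a}=\{\beta\in\mathbb{R}^p: |\beta|_0\le s,\ |\beta_i|\ge a\ \forall i \text{ with }\beta_i\neq0\}$, where $|\beta|_0$ is the number of nonzero entries. $\eta_\beta=(\mathbf 1\{\beta_1\neq0\},\dots,\mathbf 1\{\beta_p\neq0\})$. A selector is a measurable function $\tilde\eta=\tilde\eta(X,Y)$ with values in $\{0,1\}^p$; $|\tilde\eta-\eta_\beta|$ is the Hamming distance. For $\sigma>0$ define the threshold $t_\sigma(u)=\frac{a\|u\|}{2}+\frac{\sigma^2\log(\frac ps-1)}{a\|u\|}$ for $u\in\mathbb{R}^n$, and $$\psi_+(n,p,s,a,\sigma)=(p-s)\mathbf P(\sigma\varepsilon>t_\sigma(\zeta))+s\,\mathbf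 P(\sigma\varepsilon\ge a\|\zeta\|-t_\sigma(\zeta)),$$ where $\varepsilon\sim\mathcal N(0,1)$ and $\zeta\sim\mathcal N(0,\mathbb I_n)$ are independent. *)

theory Defs
  imports "HOL-Probability.Probability"
begin

definition N01 :: "real measure" where
  "N01 = density lborel std_normal_density"

definition gauss_vec :: "nat \<Rightarrow> (nat \<Rightarrow> real) measure" where
  "gauss_vec m = PiM {..<m} (\<lambda>_. N01)"

(* Gaussian design X (n x p matrix, entries X(i,j), i<n, j<p) together with the noise xi *)
definition sample_space :: "nat \<Rightarrow> nat \<Rightarrow> ((nat \<times> nat \<Rightarrow> real) \<times> (nat \<Rightarrow> real)) measure" where
  "sample_space n p = PiM ({..<n} \<times> {..<p}) (\<lambda>_. N01) \<Otimes>\<^sub>M gauss_vec n"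

definition data_space :: "nat \<Rightarrow> nat \<Rightarrow> ((nat \<times> nat \<Rightarrow> real) \<times> (nat \<Rightarrow> real)) measure" where
  "data_space n p = PiM ({..<n} \<times> {..<p}) (\<lambda>_. borel) \<Otimes>\<^sub>M PiM {..<n} (\<lambda>_. borel)"

definition observe :: "nat \<Rightarrow> nat \<Rightarrow> real \<Rightarrow> (nat \<Rightarrow> real)
    \<Rightarrow> (nat \<times> nat \<Rightarrow> real) \<times> (nat \<Rightarrow> real) \<Rightarrow> (nat \<times> nat \<Rightarrow> real) \<times> (nat \<Rightarrow> real)" where
  "observe n p \<sigma> \<beta> = (\<lambda>(X, \<xi>). (X, \<lambda>i\<in>{..<n}. (\<Sum>j<p. X (i, j) * \<beta> j) + \<sigma> * \<xi> i))"

definition selectors :: "nat \<Rightarrow> nat \<Rightarrow> ((nat \<times> nat \<Rightarrow> real) \<times> (nat \<Rightarrow> real) \<Rightarrow> (nat \<Rightarrow> bool)) set" where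
  "selectors n p = measurable (data_space n p) (PiM {..<p} (\<lambda>_. count_space UNIV))"

definition hamming :: "nat \<Rightarrow> (nat \<Rightarrow> bool) \<Rightarrow> (nat \<Rightarrow> real) \<Rightarrow> nat" where
  "hamming p e \<beta> = card {i\<in>{..<p}. e i \<noteq> (\<beta> i \<noteq> 0)}"

definition risk :: "nat \<Rightarrow> nat \<Rightarrow> real \<Rightarrow> ((nat \<times> nat \<Rightarrow> real) \<times> (nat \<Rightarrow> real) \<Rightarrow> (nat \<Rightarrow> bool))
    \<Rightarrow> (nat \<Rightarrow> real) \<Rightarrow> real" where
  "risk n p \<sigma> \<eta> \<beta> = (\<integral>\<omega>. real (hamming p (\<eta> (observe n p \<sigma> \<beta> \<omega>)) \<beta>) \<partial>sample_space n p)"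

(* Omega^p_{s,a}; vectors in R^p are functions vanishing outside {..<p} *)
definition Omega :: "nat \<Rightarrow> nat \<Rightarrow> real \<Rightarrow> (nat \<Rightarrow> real) set" where
  "Omega p s a = {\<beta>. (\<forall>i. i \<ge> p \<longrightarrow> \<beta> i = 0) \<and> card {i\<in>{..<p}. \<beta> i \<noteq> 0} \<le> s
                     \<and> (\<forall>i<p. \<beta> i \<noteq> 0 \<longrightarrow> \<bar>\<beta> i\<bar> \<ge> a)}"

definition euclid_norm :: "nat \<Rightarrow> (nat \<Rightarrow> real) \<Rightarrow> real" where
  "euclid_norm n u = sqrt (\<Sum>i<n. (u i)\<^sup>2)"

definition thr :: "nat \<Rightarrow> nat \<Rightarrow> nat \<Rightarrow> real \<Rightarrow> real \<Rightarrow> (nat \<Rightarrow> real) \<Rightarrow> real" where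
  "thr n p s a \<sigma> u = a * euclid_norm n u / 2
      + \<sigma>\<^sup>2 * ln (real p / real s - 1) / (a * euclid_norm n u)"

definition psi_plus :: "nat \<Rightarrow> nat \<Rightarrow> nat \<Rightarrow> real \<Rightarrow> real \<Rightarrow> real" where
  "psi_plus n p s a \<sigma> =
     real (p - s) * measure (gauss_vec n \<Otimes>\<^sub>M N01)
        {(\<zeta>, \<epsilon>) \<in> space (gauss_vec n \<Otimes>\<^sub>M N01). \<sigma> * \<epsilon> > thr n p s a \<sigma> \<zeta>}
   + real s * measure (gauss_vec n \<Otimes>\<^sub>M N01)
        {(\<zeta>, \<epsilon>) \<in> space (gauss_vec n \<Otimes>\<^sub>M N01). \<sigma> * \<epsilon> \<ge> a * euclid_norm n \<zeta> - thr n p s a \<sigma> \<zeta>}"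

end

(*
  The prior puts the amplitude a on a random support that contains each coordinate independently
  with probability q = s'/p. Sparsity at most s fails with small probability under it; to control
  the risk there, the selector is replaced by the zero vector whenever it selects more than 2s
  coordinates, which does not increase its Hamming loss on s-sparse vectors. A Chernoff bound with
  tilt s/s' then gives the remainder. The Bayes risk splits over coordinates into two-point tests,
  whose weights (1-q, q) dominate (s'/s)(1-s/p, s/p). Conditionally on the design, the
  Neyman-Pearson test of N(0, I) against the Gaussian shifted along the j-th column u depends on
  <u, xi>/|u| only, which is standard normal; averaging over u yields psi_plus.
*)
theory Submission
  imports Defs
begin

section \<open>Standard Gaussian vectors: shifts and one-dimensional projections\<close>

lemma prob_space_N01: "prob_space N01"
  unfolding N01_def by (rule prob_space_normal_density) simp

lemma sets_N01 [simp, measurable_cong]: "sets N01 = sets borel"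
  and space_N01 [simp]: "space N01 = UNIV"
  by (simp_all add: N01_def)

lemma prob_space_gauss_vec: "prob_space (gauss_vec n)"
  unfolding gauss_vec_def by (intro prob_space_PiM prob_space_N01)

lemma sets_gauss_vec [simp, measurable_cong]: "sets (gauss_vec n) = sets (PiM {..<n} (\<lambda>_. borel))"
  unfolding gauss_vec_def by (intro sets_PiM_cong) auto

lemma space_gauss_vec [simp]: "space (gauss_vec n) = PiE {..<n} (\<lambda>_. UNIV)"
  by (simp add: gauss_vec_def space_PiM)

lemma euclid_norm_measurable [measurable]: "euclid_norm n \<in> borel_measurable (gauss_vec n)"
  unfolding euclid_norm_def by measurable

lemma euclid_norm_sq: "(euclid_norm n u)\<^sup>2 = (\<Sum>i<n. (u i)\<^sup>2)"
  unfolding euclid_norm_def by (simp add: sum_nonneg)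

text \<open>The exponential is the ratio of the N(c, 1) density to the N(0, 1) density. This is the
  one-dimensional factor of the Gaussian shift formula that follows.\<close>

lemma distr_N01_translate:
  "distr N01 borel (\<lambda>x. x + c) = density N01 (\<lambda>x. ennreal (exp (c * x - c\<^sup>2 / 2)))"
proof -
  interpret prob_space N01 by (rule prob_space_N01)
  have "distributed N01 lborel (\<lambda>x. x) std_normal_density"
    by (simp add: distributed_def N01_def distr_id2)
  from normal_density_affine[OF this, of 1 c]
  have "distr N01 lborel (\<lambda>x. c + x) = density lborel (normal_density c 1)"
    by (simp add: distributed_def)
  moreover have "normal_density c 1 = (\<lambda>x. std_normal_density x * exp (c * x - c\<^sup>2 / 2))"
    by (auto simp: fun_eq_iff normal_density_def simp flip: exp_add)
       (simp add: power2_eq_square algebra_simps diff_divide_distrib add_divide_distrib)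
  moreover have "distr N01 lborel (\<lambda>x. c + x) = distr N01 borel (\<lambda>x. x + c)"
    by (intro distr_cong) (auto simp: add.commute)
  ultimately show ?thesis
    by (simp add: N01_def density_density_eq ennreal_mult)
qed

text \<open>Cameron-Martin formula in finite dimension. Both sides agree on boxes with the product
  of the shifted marginals \<open>M i\<close>: the preimage of a box under the shift is a box, and
  the exponential density factors over the coordinates.\<close>

lemma distr_gauss_vec_translate:
  fixes w :: "nat \<Rightarrow> real"
  shows "distr (gauss_vec n) (gauss_vec n) (\<lambda>\<xi>. \<lambda>i\<in>{..<n}. \<xi> i + w i)
    = density (gauss_vec n) (\<lambda>\<xi>. ennreal (exp ((\<Sum>i<n. w i * \<xi> i) - (\<Sum>i<n. (w i)\<^sup>2) / 2)))"
    (is "?L = ?R")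
proof -
  define M where "M i = distr N01 borel (\<lambda>x. x + w i)" for i
  have sM [simp, measurable_cong]: "sets (M i) = sets borel" for i by (simp add: M_def)
  interpret N: product_sigma_finite "\<lambda>_::nat. N01"
    unfolding product_sigma_finite_def
    using prob_space_imp_sigma_finite[OF prob_space_N01] by simp
  have pM: "prob_space (M i)" for i
    unfolding M_def by (intro prob_space.prob_space_distr prob_space_N01) auto
  interpret P: product_sigma_finite M
    unfolding product_sigma_finite_def using prob_space_imp_sigma_finite[OF pM] by simp
  have sets_P: "sets (PiM {..<n} M) = sets (PiM {..<n} (\<lambda>_. borel))"
    by (intro sets_PiM_cong) auto
  have L: "?L = PiM {..<n} M"
  proof (rule P.PiM_eqI)
    show "sets ?L = sets (PiM {..<n} M)" using sets_P by simp
    fix A assume A: "\<And>i. i \<in> {..<n} \<Longrightarrow> A i \<in> sets (M i)"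
    have "emeasure ?L (Pi\<^sub>E {..<n} A)
        = emeasure (gauss_vec n) (Pi\<^sub>E {..<n} (\<lambda>i. (\<lambda>x. x + w i) -` A i))"
    proof -
      have "(\<lambda>\<xi>. \<lambda>i\<in>{..<n}. \<xi> i + w i) -` Pi\<^sub>E {..<n} A \<inter> space (gauss_vec n)
          = Pi\<^sub>E {..<n} (\<lambda>i. (\<lambda>x. x + w i) -` A i)"
        by (auto simp: PiE_iff extensional_def)
      moreover have "Pi\<^sub>E {..<n} A \<in> sets (gauss_vec n)"
        unfolding sets_gauss_vec using A by (intro sets_PiM_I_finite) auto
      moreover have "(\<lambda>\<xi>. \<lambda>i\<in>{..<n}. \<xi> i + w i) \<in> gauss_vec n \<rightarrow>\<^sub>M gauss_vec n"
        unfolding gauss_vec_def by measurable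
      ultimately show ?thesis by (simp add: emeasure_distr)
    qed
    also have "\<dots> = (\<Prod>i<n. emeasure N01 ((\<lambda>x. x + w i) -` A i))"
      unfolding gauss_vec_def
    proof (rule N.emeasure_PiM)
      fix i assume "i \<in> {..<n}"
      then have "A i \<in> sets borel" using A by auto
      then have "(\<lambda>x. x + w i) -` A i \<inter> space borel \<in> sets borel"
        by (intro measurable_sets[of _ borel borel]) auto
      then show "(\<lambda>x. x + w i) -` A i \<in> sets N01" by simp
    qed simp
    also have "\<dots> = (\<Prod>i<n. emeasure (M i) (A i))"
      using A by (intro prod.cong refl) (simp add: M_def emeasure_distr)
    finally show "emeasure ?L (Pi\<^sub>E {..<n} A) = (\<Prod>i\<in>{..<n}. emeasure (M i) (A i))" .
  qed simp
  have R: "?R = PiM {..<n} M"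
  proof (rule P.PiM_eqI)
    show "sets ?R = sets (PiM {..<n} M)" using sets_P by simp
    fix A assume A: "\<And>i. i \<in> {..<n} \<Longrightarrow> A i \<in> sets (M i)"
    then have A': "\<And>i. i < n \<Longrightarrow> A i \<in> sets borel" by auto
    let ?f = "\<lambda>i x. ennreal (exp (w i * x - (w i)\<^sup>2 / 2)) * indicator (A i) x"
    have "emeasure ?R (Pi\<^sub>E {..<n} A)
       = (\<integral>\<^sup>+\<xi>. ennreal (exp ((\<Sum>i<n. w i * \<xi> i) - (\<Sum>i<n. (w i)\<^sup>2) / 2)) * indicator (Pi\<^sub>E {..<n} A) \<xi> \<partial>gauss_vec n)"
      using A' by (subst emeasure_density) (auto intro!: sets_PiM_I_finite)
    also have "\<dots> = (\<integral>\<^sup>+\<xi>. (\<Prod>i<n. ?f i (\<xi> i)) \<partial>gauss_vec n)"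
    proof (rule nn_integral_cong)
      fix \<xi> assume "\<xi> \<in> space (gauss_vec n)"
      \<comment> \<open>Membership in the box also asks for extensionality, which holds because
        \<xi> lies in the space.\<close>
      then have "indicator (Pi\<^sub>E {..<n} A) \<xi> = (\<Prod>i<n. indicator (A i) (\<xi> i) :: ennreal)"
        by (auto simp: indicator_def PiE_iff prod_zero_iff space_gauss_vec)
      then show "ennreal (exp ((\<Sum>i<n. w i * \<xi> i) - (\<Sum>i<n. (w i)\<^sup>2) / 2)) * indicator (Pi\<^sub>E {..<n} A) \<xi>
          = (\<Prod>i<n. ?f i (\<xi> i))"
        by (simp add: prod.distrib prod_ennreal exp_sum[symmetric] sum_subtractf sum_divide_distrib)
    qed
    also have "\<dots> = (\<Prod>i<n. \<integral>\<^sup>+x. ?f i x \<partial>N01)"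
      unfolding gauss_vec_def using A' by (intro N.product_nn_integral_prod) auto
    also have "\<dots> = (\<Prod>i<n. emeasure (M i) (A i))"
      using A' by (intro prod.cong refl) (simp add: M_def distr_N01_translate emeasure_density)
    finally show "emeasure ?R (Pi\<^sub>E {..<n} A) = (\<Prod>i\<in>{..<n}. emeasure (M i) (A i))" .
  qed simp
  show ?thesis using L R by simp
qed

text \<open>The terms u i * \<xi> i are independent centred normals with variances (u i)^2, so their
  sum has variance |u|^2 and division by |u| standardises it.\<close>

lemma distr_gauss_vec_inner:
  assumes "euclid_norm n u \<noteq> 0"
  shows "distr (gauss_vec n) borel (\<lambda>\<xi>. (\<Sum>i<n. u i * \<xi> i) / euclid_norm n u) = N01"
proof -
  interpret prob_space "gauss_vec n" by (rule prob_space_gauss_vec)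
  \<comment> \<open>Coordinates with u i = 0 are left out, since the law of their term is degenerate
    and has no density.\<close>
  define I where "I = {i. i < n \<and> u i \<noteq> 0}"
  have sum_I: "(\<Sum>i\<in>I. f i) = (\<Sum>i<n. f i)" if "\<And>i. u i = 0 \<Longrightarrow> f i = 0" for f :: "nat \<Rightarrow> real"
    using that by (intro sum.mono_neutral_left) (auto simp: I_def)
  have norm: "euclid_norm n u = sqrt (\<Sum>i\<in>I. (u i)\<^sup>2)"
    unfolding euclid_norm_def by (subst sum_I) auto
  with assms have "I \<noteq> {}" by auto
  then have n: "{..<n} \<noteq> {}" by (auto simp: I_def)
  have pos: "euclid_norm n u > 0" using assms by (simp add: euclid_norm_def sum_nonneg less_le)
  have coord: "distr (gauss_vec n) N01 (\<lambda>\<xi>. \<xi> i) = N01" if "i < n" for i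
    unfolding gauss_vec_def using that by (intro distr_PiM_component prob_space_N01) auto
  have "indep_vars (\<lambda>_. N01) (\<lambda>i \<xi>. \<xi> i) {..<n}"
  proof (subst indep_vars_iff_distr_eq_PiM'[OF n])
    show "(distr (gauss_vec n) (PiM {..<n} (\<lambda>_. N01)) (\<lambda>x. \<lambda>i\<in>{..<n}. x i))
        = PiM {..<n} (\<lambda>i. distr (gauss_vec n) N01 (\<lambda>\<xi>. \<xi> i))"
    proof -
      have "distr (gauss_vec n) (PiM {..<n} (\<lambda>_. N01)) (\<lambda>x. \<lambda>i\<in>{..<n}. x i)
          = distr (gauss_vec n) (gauss_vec n) (\<lambda>x. x)"
        by (rule distr_cong) (auto simp: gauss_vec_def space_PiM PiE_iff extensional_def)
      also have "\<dots> = PiM {..<n} (\<lambda>_. N01)" by (simp add: distr_id2 gauss_vec_def)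
      also have "\<dots> = PiM {..<n} (\<lambda>i. distr (gauss_vec n) N01 (\<lambda>\<xi>. \<xi> i))"
        by (rule PiM_cong) (simp_all add: coord)
      finally show ?thesis .
    qed
  qed (auto simp: gauss_vec_def)
  then have "indep_vars (\<lambda>_. N01) (\<lambda>i \<xi>. \<xi> i) I"
    by (rule indep_vars_subset) (auto simp: I_def)
  then have ind: "indep_vars (\<lambda>_. borel) (\<lambda>i \<xi>. u i * \<xi> i) I"
    by (rule indep_vars_compose2) auto
  have D: "distributed (gauss_vec n) lborel (\<lambda>\<xi>. u i * \<xi> i) (normal_density 0 \<bar>u i\<bar>)" if "i \<in> I" for i
  proof -
    have "distr (gauss_vec n) lborel (\<lambda>\<xi>. \<xi> i) = distr (gauss_vec n) N01 (\<lambda>\<xi>. \<xi> i)"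
      by (rule distr_cong) auto
    then have "distributed (gauss_vec n) lborel (\<lambda>\<xi>. \<xi> i) std_normal_density"
      using that coord by (simp add: distributed_def I_def N01_def)
    from normal_density_affine[OF this, of "u i" 0] show ?thesis using that by (simp add: I_def)
  qed
  have "distributed (gauss_vec n) lborel (\<lambda>\<xi>. \<Sum>i\<in>I. u i * \<xi> i)
      (normal_density (\<Sum>i\<in>I. 0) (sqrt (\<Sum>i\<in>I. \<bar>u i\<bar>\<^sup>2)))"
    using \<open>I \<noteq> {}\<close> ind D by (intro sum_indep_normal) (auto simp: I_def)
  then have "distributed (gauss_vec n) lborel (\<lambda>\<xi>. \<Sum>i<n. u i * \<xi> i) (normal_density 0 (euclid_norm n u))"
    by (simp add: norm sum_I)
  from normal_density_affine[OF this pos, of "1 / euclid_norm n u" 0]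
  have "distr (gauss_vec n) lborel (\<lambda>\<xi>. (\<Sum>i<n. u i * \<xi> i) / euclid_norm n u) = N01"
    using pos by (simp add: distributed_def N01_def)
  moreover have "distr (gauss_vec n) lborel (\<lambda>\<xi>. (\<Sum>i<n. u i * \<xi> i) / euclid_norm n u)
     = distr (gauss_vec n) borel (\<lambda>\<xi>. (\<Sum>i<n. u i * \<xi> i) / euclid_norm n u)"
    by (rule distr_cong) auto
  ultimately show ?thesis by simp
qed

section \<open>Optimal two-point tests for a fixed design\<close>

lemma neyman_pearson:
  fixes L :: "'a \<Rightarrow> real"
  assumes "finite_measure M" "finite_measure (density M L)"
    and [measurable]: "L \<in> borel_measurable M" and L: "\<And>x. 0 \<le> L x"
    and [measurable]: "A \<in> sets M"
  shows "c1 * measure M {x \<in> space M. c1 < c2 * L x}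
      + c2 * measure (density M L) {x \<in> space M. \<not> c1 < c2 * L x}
    \<le> c1 * measure M A + c2 * measure (density M L) (space M - A)"
proof -
  interpret M: finite_measure M by fact
  interpret N: finite_measure "density M L" by fact
  \<comment> \<open>Integrability of the likelihood ratio comes from the finiteness of the measure
    that it defines.\<close>
  have 1: "integrable M (\<lambda>x. L x * indicator B x)"
    and 2: "measure (density M L) B = (\<integral>x. L x * indicator B x \<partial>M)"
    if [measurable]: "B \<in> sets M" for B
  proof -
    have "integrable (density M L) (indicator B :: _ \<Rightarrow> real)"
      by (rule integrable_real_indicator) (simp_all add: N.emeasure_eq_measure)
    then show "integrable M (\<lambda>x. L x * indicator B x)"
      by (subst (asm) integrable_density) (auto simp: L)
    have "measure (density M L) B = (\<integral>x. indicator B x \<partial>density M L)"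
      by (simp add: sets.Int_space_eq2)
    also have "\<dots> = (\<integral>x. L x * indicator B x \<partial>M)"
      by (subst integral_density) (auto simp: L)
    finally show "measure (density M L) B = (\<integral>x. L x * indicator B x \<partial>M)" .
  qed
  have eq: "c1 * measure M B + c2 * measure (density M L) (space M - B)
      = (\<integral>x. c1 * indicator B x + c2 * (L x * indicator (space M - B) x) \<partial>M)"
    and int: "integrable M (\<lambda>x. c1 * indicator B x + c2 * (L x * indicator (space M - B) x))"
    if [measurable]: "B \<in> sets M" for B
    using 1[of "space M - B"] that by (simp_all add: 2 M.emeasure_eq_measure sets.Int_space_eq2)
  let ?D = "{x \<in> space M. c1 < c2 * L x}"
  have D: "{x \<in> space M. \<not> c1 < c2 * L x} = space M - ?D" by auto
  \<comment> \<open>By \<open>eq\<close>, the weighted error of a rejection region B integrates c1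
    on B and c2 * L off B. The region \<open>?D\<close> picks the smaller of the two at every
    point.\<close>
  show ?thesis
    unfolding D
    by (subst (1 2) eq, measurable, intro integral_mono int) (auto simp: indicator_def)
qed

text \<open>The event A is read as a test that declares the noise shifted by (a / \<sigma>) u, and
  the right-hand side is its weighted error. The likelihood ratio depends on \<xi> only through Z =
  <u, \<xi>> / |u|, so the errors of the Neyman-Pearson test are one-dimensional normal
  tails.\<close>

lemma two_point_bound_fixed_design:
  assumes a: "a > 0" and \<sigma>: "\<sigma> > 0" and s: "0 < s" "s < p"
    and u: "euclid_norm n u \<noteq> 0" and A: "A \<in> sets (gauss_vec n)"
  shows "real (p - s) * measure N01 {\<epsilon>. \<sigma> * \<epsilon> > thr n p s a \<sigma> u}
      + real s * measure N01 {\<epsilon>. \<sigma> * \<epsilon> \<ge> a * euclid_norm n u - thr n p s a \<sigma> u}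
    \<le> real (p - s) * measure (gauss_vec n) A
      + real s * measure (gauss_vec n) {\<xi> \<in> space (gauss_vec n). (\<lambda>i\<in>{..<n}. \<xi> i + a / \<sigma> * u i) \<notin> A}"
proof -
  interpret prob_space "gauss_vec n" by (rule prob_space_gauss_vec)
  define r where "r = euclid_norm n u"
  define t where "t = thr n p s a \<sigma> u"
  define Z where "Z \<xi> = (\<Sum>i<n. u i * \<xi> i) / r" for \<xi> :: "nat \<Rightarrow> real"
  define w where "w i = a / \<sigma> * u i" for i
  define L where "L \<xi> = exp ((\<Sum>i<n. w i * \<xi> i) - (\<Sum>i<n. (w i)\<^sup>2) / 2)" for \<xi> :: "nat \<Rightarrow> real"
  define \<tau> where "\<tau> \<xi> = (\<lambda>i\<in>{..<n}. \<xi> i + w i)" for \<xi> :: "nat \<Rightarrow> real"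
  have r: "r > 0" using u by (simp add: r_def euclid_norm_def sum_nonneg less_le)
  have [measurable]: "\<tau> \<in> gauss_vec n \<rightarrow>\<^sub>M gauss_vec n" unfolding \<tau>_def gauss_vec_def by measurable
  have [measurable]: "Z \<in> borel_measurable (gauss_vec n)" unfolding Z_def by measurable
  have [measurable]: "L \<in> borel_measurable (gauss_vec n)" unfolding L_def by measurable
  note [measurable] = A
  have shift: "distr (gauss_vec n) (gauss_vec n) \<tau> = density (gauss_vec n) L"
    unfolding \<tau>_def L_def by (rule distr_gauss_vec_translate)
  have fin: "finite_measure (density (gauss_vec n) L)"
    unfolding shift[symmetric] by (intro prob_space.finite_measure prob_space_distr) measurable
  \<comment> \<open>This is the origin of \<open>thr\<close>: take logarithms in L > p / s - 1 and
    multiply by \<sigma>^2 / (a r).\<close>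
  have ratio: "real (p - s) < real s * L \<xi> \<longleftrightarrow> \<sigma> * Z \<xi> > t" for \<xi>
  proof -
    have "(\<Sum>i<n. w i * \<xi> i) = a / \<sigma> * (\<Sum>i<n. u i * \<xi> i)"
      by (simp add: w_def sum_distrib_left mult.assoc)
    moreover have "(\<Sum>i<n. (w i)\<^sup>2) = (a / \<sigma>)\<^sup>2 * r\<^sup>2"
      unfolding r_def euclid_norm_sq by (simp add: w_def sum_distrib_left power_mult_distrib power_divide)
    ultimately have "L \<xi> = exp (a / \<sigma> * r * Z \<xi> - (a / \<sigma>)\<^sup>2 * r\<^sup>2 / 2)"
      using r by (simp add: L_def Z_def)
    moreover have "real (p - s) < real s * y \<longleftrightarrow> real p / real s - 1 < y" for y
      using s by (simp add: field_simps of_nat_diff)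
    moreover have "real p / real s - 1 > 0" using s by simp
    ultimately have "real (p - s) < real s * L \<xi>
        \<longleftrightarrow> ln (real p / real s - 1) < a / \<sigma> * r * Z \<xi> - (a / \<sigma>)\<^sup>2 * r\<^sup>2 / 2"
      by (metis exp_less_cancel_iff exp_ln)
    also have "\<dots> \<longleftrightarrow> t < \<sigma> * Z \<xi>"
      using r a \<sigma> unfolding t_def thr_def r_def[symmetric]
      by (simp add: field_simps power2_eq_square)
    finally show ?thesis .
  qed
  have Z_shift: "Z (\<tau> \<xi>) = Z \<xi> + a / \<sigma> * r" for \<xi>
  proof -
    have "(\<Sum>i<n. u i * (\<xi> i + a / \<sigma> * u i)) = (\<Sum>i<n. u i * \<xi> i) + a / \<sigma> * (\<Sum>i<n. (u i)\<^sup>2)"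
      by (simp add: sum.distrib sum_distrib_left algebra_simps power2_eq_square)
    also have "\<dots> = (\<Sum>i<n. u i * \<xi> i) + a / \<sigma> * (r * r)"
      unfolding r_def euclid_norm_sq[symmetric] by (simp add: power2_eq_square)
    finally show ?thesis using r by (simp add: Z_def \<tau>_def w_def add_divide_distrib)
  qed
  have lawZ: "distr (gauss_vec n) borel Z = N01"
    unfolding Z_def r_def by (rule distr_gauss_vec_inner[OF u])
  \<comment> \<open>The miss event under the shift is \<sigma> Z + a r \<le> t, that is \<sigma> (-
    Z) \<ge> a r - t. Symmetry of the normal law, seen by replacing u by -u, gives it the form used
    in \<open>psi_plus\<close>.\<close>
  have lawZ': "distr (gauss_vec n) borel (\<lambda>\<xi>. - Z \<xi>) = N01"
  proof -
    have "euclid_norm n (\<lambda>i. - u i) = r" by (simp add: euclid_norm_def r_def)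
    with distr_gauss_vec_inner[of n "\<lambda>i. - u i"] r show ?thesis
      by (simp add: Z_def sum_negf)
  qed
  have "measure N01 {\<epsilon>. \<sigma> * \<epsilon> > t} = measure (gauss_vec n) {\<xi> \<in> space (gauss_vec n). \<sigma> * Z \<xi> > t}"
    unfolding lawZ[symmetric]
    by (subst measure_distr) (auto intro!: arg_cong[where f = "measure _"])
  moreover have "measure N01 {\<epsilon>. \<sigma> * \<epsilon> \<ge> a * r - t}
      = measure (density (gauss_vec n) L) {\<xi> \<in> space (gauss_vec n). \<not> \<sigma> * Z \<xi> > t}"
  proof -
    have "measure N01 {\<epsilon>. \<sigma> * \<epsilon> \<ge> a * r - t}
        = measure (gauss_vec n) {\<xi> \<in> space (gauss_vec n). \<sigma> * (- Z \<xi>) \<ge> a * r - t}"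
      unfolding lawZ'[symmetric]
      by (subst measure_distr) (auto intro!: arg_cong[where f = "measure _"])
    also have "\<dots> = measure (gauss_vec n) {\<xi> \<in> space (gauss_vec n). \<not> \<sigma> * Z (\<tau> \<xi>) > t}"
      using \<sigma> by (simp add: Z_shift algebra_simps not_less)
    also have "\<dots> = measure (distr (gauss_vec n) (gauss_vec n) \<tau>) {\<xi> \<in> space (gauss_vec n). \<not> \<sigma> * Z \<xi> > t}"
      by (subst measure_distr) (auto intro!: arg_cong[where f = "measure _"] simp: \<tau>_def)
    finally show ?thesis unfolding shift .
  qed
  moreover have "measure (gauss_vec n) {\<xi> \<in> space (gauss_vec n). \<tau> \<xi> \<notin> A}
      = measure (density (gauss_vec n) L) (space (gauss_vec n) - A)"
  proof -
    have "\<tau> -` (space (gauss_vec n) - A) \<inter> space (gauss_vec n) = {\<xi> \<in> space (gauss_vec n). \<tau> \<xi> \<notin> A}"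
      using measurable_space[OF \<open>\<tau> \<in> gauss_vec n \<rightarrow>\<^sub>M gauss_vec n\<close>] by blast
    moreover have "measure (distr (gauss_vec n) (gauss_vec n) \<tau>) (space (gauss_vec n) - A)
        = measure (gauss_vec n) (\<tau> -` (space (gauss_vec n) - A) \<inter> space (gauss_vec n))"
      by (rule measure_distr) measurable
    ultimately show ?thesis unfolding shift[symmetric] by simp
  qed
  moreover have "real (p - s) * measure (gauss_vec n) {\<xi> \<in> space (gauss_vec n). \<sigma> * Z \<xi> > t}
      + real s * measure (density (gauss_vec n) L) {\<xi> \<in> space (gauss_vec n). \<not> \<sigma> * Z \<xi> > t}
    \<le> real (p - s) * measure (gauss_vec n) A
      + real s * measure (density (gauss_vec n) L) (space (gauss_vec n) - A)"
    unfolding ratio[symmetric]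
    by (rule neyman_pearson[OF finite_measure_axioms fin \<open>L \<in> borel_measurable (gauss_vec n)\<close> _ A])
       (simp add: L_def)
  ultimately show ?thesis
    unfolding t_def[symmetric] r_def[symmetric] \<tau>_def w_def by simp
qed

section \<open>Averaging the two-point bound over the Gaussian design\<close>

lemma measure_pair_iterated:
  assumes "prob_space M" "prob_space N" and B: "B \<in> sets (M \<Otimes>\<^sub>M N)"
  shows "integrable M (\<lambda>x. measure N {y \<in> space N. (x, y) \<in> B})"
    and "measure (M \<Otimes>\<^sub>M N) B = (\<integral>x. measure N {y \<in> space N. (x, y) \<in> B} \<partial>M)"
proof -
  interpret M: prob_space M by fact
  interpret N: prob_space N by fact
  interpret P: pair_prob_space M N ..
  have int: "integrable (M \<Otimes>\<^sub>M N) (indicator B :: _ \<Rightarrow> real)"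
    using B by (intro integrable_real_indicator) (simp_all add: P.emeasure_eq_measure)
  have eq: "(\<integral>y. indicator B (x, y) \<partial>N) = measure N {y \<in> space N. (x, y) \<in> B}" if "x \<in> space M" for x
  proof -
    have "(\<integral>y. indicator B (x, y) \<partial>N) = (\<integral>y. indicator {y \<in> space N. (x, y) \<in> B} y \<partial>N :: real)"
      by (intro Bochner_Integration.integral_cong) (auto simp: indicator_def)
    also have "\<dots> = measure N {y \<in> space N. (x, y) \<in> B}" by (simp add: Int_def conj_commute)
    finally show ?thesis .
  qed
  have "integrable M (\<lambda>x. \<integral>y. indicator B (x, y) \<partial>N :: real)"
    by (rule P.integrable_fst'[OF int])
  then show "integrable M (\<lambda>x. measure N {y \<in> space N. (x, y) \<in> B})"
    by (subst (asm) Bochner_Integration.integrable_cong[OF refl eq])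
  have "measure (M \<Otimes>\<^sub>M N) B = (\<integral>z. indicator B z \<partial>(M \<Otimes>\<^sub>M N))"
    using sets.sets_into_space[OF B] by (simp add: Int_absorb2)
  also have "\<dots> = (\<integral>x. \<integral>y. indicator B (x, y) \<partial>N \<partial>M)"
    by (rule P.integral_fst'[OF int, symmetric])
  also have "\<dots> = (\<integral>x. measure N {y \<in> space N. (x, y) \<in> B} \<partial>M)"
    by (rule Bochner_Integration.integral_cong[OF refl eq])
  finally show "measure (M \<Otimes>\<^sub>M N) B = (\<integral>x. measure N {y \<in> space N. (x, y) \<in> B} \<partial>M)" .
qed

abbreviation gauss_design :: "nat \<Rightarrow> nat \<Rightarrow> (nat \<times> nat \<Rightarrow> real) measure" where
  "gauss_design n p \<equiv> PiM ({..<n} \<times> {..<p}) (\<lambda>_. N01)"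

text \<open>The column is a reindexing of the product along the injection i -> (i, j). Its law is
  that of the vector \<zeta> in \<open>psi_plus\<close>.\<close>

lemma distr_gauss_design_column:
  assumes "j < p"
  shows "distr (gauss_design n p) (gauss_vec n) (\<lambda>X. \<lambda>i\<in>{..<n}. X (i, j)) = gauss_vec n"
  using distr_PiM_reindex[of "{..<n} \<times> {..<p}" "\<lambda>_. N01" "\<lambda>i. (i, j)" "{..<n}"] assms
  by (simp add: prob_space_N01 gauss_vec_def inj_on_def)

text \<open>Excludes the designs for which the two hypotheses on coordinate j coincide and the
  fixed-design bound does not apply. As n \<ge> 1 there is an entry in row 0, and it is almost
  surely nonzero.\<close>

lemma AE_gauss_design_column:
  assumes "j < p" "n \<ge> 1"
  shows "AE X in gauss_design n p. euclid_norm n (\<lambda>i\<in>{..<n}. X (i, j)) \<noteq> 0"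
proof -
  have "AE x in N01. x \<noteq> 0"
    unfolding N01_def by (subst AE_density) (auto intro: AE_mp[OF AE_lborel_singleton[of 0]])
  then have "AE X in gauss_design n p. X (0, j) \<noteq> 0"
    using assms by (intro AE_PiM_component prob_space_N01) auto
  then show ?thesis
  proof eventually_elim
    case (elim X)
    have "0 < (X (0, j))\<^sup>2" using elim by simp
    also have "\<dots> \<le> (\<Sum>i<n. (X (i, j))\<^sup>2)"
      using assms by (intro member_le_sum) auto
    finally show ?case by (simp add: euclid_norm_def)
  qed
qed

lemma observe_measurable [measurable]:
  "observe n p \<sigma> \<beta> \<in> sample_space n p \<rightarrow>\<^sub>M data_space n p"
  unfolding observe_def sample_space_def data_space_def by measurable

lemma prob_space_sample_space: "prob_space (sample_space n p)"
proof -
  interpret D: prob_space "gauss_design n p" by (intro prob_space_PiM prob_space_N01)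
  interpret G: prob_space "gauss_vec n" by (rule prob_space_gauss_vec)
  interpret pair_prob_space "gauss_design n p" "gauss_vec n" ..
  show ?thesis unfolding sample_space_def by unfold_locales
qed

text \<open>Switching on coordinate j adds a times the j-th column to the response, and the noise
  can absorb this as a shift scaled by 1 / \<sigma>. The column appears as a restricted function so
  that it folds to \<open>col X\<close> in the next proof.\<close>

lemma observe_fun_upd:
  assumes "\<sigma> > 0" "j < p" "\<beta> j = 0"
  shows "observe n p \<sigma> (\<beta>(j := a)) (X, \<xi>)
    = observe n p \<sigma> \<beta> (X, \<lambda>i\<in>{..<n}. \<xi> i + a / \<sigma> * (\<lambda>i\<in>{..<n}. X (i, j)) i)"
proof -
  have "(\<Sum>k<p. X (i, k) * (\<beta>(j := a)) k) = (\<Sum>k<p. X (i, k) * \<beta> k) + a * X (i, j)" for i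
    using assms by (simp add: sum.remove[of "{..<p}" j])
  then show ?thesis
    using assms by (auto simp: observe_def fun_eq_iff field_simps)
qed

text \<open>\<open>Q\<close> plays the role of the j-th component of a selector, and the other
  coordinates of \<beta> are arbitrary but fixed. For each design X with a nonzero j-th column the
  fixed-design bound applies to the sections of the two error events; integrating over X turns its
  left-hand side into \<open>psi_plus\<close>.\<close>

lemma two_point_bound:
  assumes a: "a > 0" and \<sigma>: "\<sigma> > 0" and s: "0 < s" "s < p" and n: "n \<ge> 1"
    and j: "j < p" and \<beta>: "\<beta> j = 0" and [measurable]: "Measurable.pred (data_space n p) Q"
  shows "psi_plus n p s a \<sigma>
    \<le> real (p - s) * measure (sample_space n p) {\<omega> \<in> space (sample_space n p). Q (observe n p \<sigma> \<beta> \<omega>)}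
      + real s * measure (sample_space n p) {\<omega> \<in> space (sample_space n p). \<not> Q (observe n p \<sigma> (\<beta>(j := a)) \<omega>)}"
proof -
  let ?D = "gauss_design n p" and ?G = "gauss_vec n"
  have pD: "prob_space ?D" by (intro prob_space_PiM prob_space_N01)
  define col where "col X = (\<lambda>i\<in>{..<n}. X (i, j))" for X :: "nat \<times> nat \<Rightarrow> real"
  have [measurable]: "col \<in> ?D \<rightarrow>\<^sub>M ?G"
    unfolding col_def gauss_vec_def using j by (intro measurable_restrict measurable_component_singleton) auto
  \<comment> \<open>The fixed-design lower bound as a function of the column u.\<close>
  define h where "h u = real (p - s) * measure N01 {\<epsilon>. \<sigma> * \<epsilon> > thr n p s a \<sigma> u}
      + real s * measure N01 {\<epsilon>. \<sigma> * \<epsilon> \<ge> a * euclid_norm n u - thr n p s a \<sigma> u}" for u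
  have [measurable]: "thr n p s a \<sigma> \<in> borel_measurable ?G"
    unfolding thr_def by measurable
  have psi: "integrable ?G h" "psi_plus n p s a \<sigma> = (\<integral>u. h u \<partial>?G)"
  proof -
    have 1: "{(u, \<epsilon>) \<in> space (?G \<Otimes>\<^sub>M N01). \<sigma> * \<epsilon> > thr n p s a \<sigma> u} \<in> sets (?G \<Otimes>\<^sub>M N01)"
      and 2: "{(u, \<epsilon>) \<in> space (?G \<Otimes>\<^sub>M N01). \<sigma> * \<epsilon> \<ge> a * euclid_norm n u - thr n p s a \<sigma> u} \<in> sets (?G \<Otimes>\<^sub>M N01)"
      unfolding case_prod_beta prod.collapse by measurable
    note m1 = measure_pair_iterated[OF prob_space_gauss_vec prob_space_N01 1]
    note m2 = measure_pair_iterated[OF prob_space_gauss_vec prob_space_N01 2]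
    have h: "h u = real (p - s) * measure N01 {\<epsilon> \<in> space N01. (u, \<epsilon>) \<in> {(u, \<epsilon>) \<in> space (?G \<Otimes>\<^sub>M N01). \<sigma> * \<epsilon> > thr n p s a \<sigma> u}}
      + real s * measure N01 {\<epsilon> \<in> space N01. (u, \<epsilon>) \<in> {(u, \<epsilon>) \<in> space (?G \<Otimes>\<^sub>M N01). \<sigma> * \<epsilon> \<ge> a * euclid_norm n u - thr n p s a \<sigma> u}}"
      if "u \<in> space ?G" for u
      using that by (simp add: h_def space_pair_measure)
    show "integrable ?G h"
      using m1(1) m2(1) by (subst Bochner_Integration.integrable_cong[OF refl h]) auto
    show "psi_plus n p s a \<sigma> = (\<integral>u. h u \<partial>?G)"
      unfolding psi_plus_def m1(2) m2(2)
      using m1(1) m2(1) by (subst Bochner_Integration.integral_cong[OF refl h]) auto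
  qed
  have lawcol: "distr ?D ?G col = ?G"
    unfolding col_def by (rule distr_gauss_design_column[OF j])
  have [measurable]: "h \<in> borel_measurable ?G" using psi(1) by auto
  have psi_design: "integrable ?D (\<lambda>X. h (col X))" "psi_plus n p s a \<sigma> = (\<integral>X. h (col X) \<partial>?D)"
  proof -
    have "integrable (distr ?D ?G col) h" unfolding lawcol by (rule psi)
    then show "integrable ?D (\<lambda>X. h (col X))" by (rule integrable_distr[rotated]) measurable
    have "(\<integral>X. h (col X) \<partial>?D) = (\<integral>u. h u \<partial>distr ?D ?G col)"
      by (rule integral_distr[symmetric]) measurable
    then show "psi_plus n p s a \<sigma> = (\<integral>X. h (col X) \<partial>?D)" unfolding psi(2) lawcol by simp
  qed
  define B0 where "B0 = {\<omega> \<in> space (sample_space n p). Q (observe n p \<sigma> \<beta> \<omega>)}"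
  define B1 where "B1 = {\<omega> \<in> space (sample_space n p). \<not> Q (observe n p \<sigma> (\<beta>(j := a)) \<omega>)}"
  have B0: "B0 \<in> sets (?D \<Otimes>\<^sub>M ?G)" and B1: "B1 \<in> sets (?D \<Otimes>\<^sub>M ?G)"
    unfolding B0_def B1_def sample_space_def[symmetric] by measurable
  note m0 = measure_pair_iterated[OF pD prob_space_gauss_vec B0]
  note m1 = measure_pair_iterated[OF pD prob_space_gauss_vec B1]
  have "(\<integral>X. h (col X) \<partial>?D) \<le> (\<integral>X. real (p - s) * measure ?G {\<xi> \<in> space ?G. (X, \<xi>) \<in> B0}
      + real s * measure ?G {\<xi> \<in> space ?G. (X, \<xi>) \<in> B1} \<partial>?D)"
  proof (rule integral_mono_AE)
    show "AE X in ?D. h (col X) \<le> real (p - s) * measure ?G {\<xi> \<in> space ?G. (X, \<xi>) \<in> B0}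
      + real s * measure ?G {\<xi> \<in> space ?G. (X, \<xi>) \<in> B1}"
      using AE_gauss_design_column[OF j n] AE_space
    proof eventually_elim
      case (elim X)
      have u: "euclid_norm n (col X) \<noteq> 0" using elim by (simp add: col_def)
      have A: "{\<xi> \<in> space ?G. (X, \<xi>) \<in> B0} \<in> sets ?G"
      proof -
        have "Pair X -` B0 = {\<xi> \<in> space ?G. (X, \<xi>) \<in> B0}"
          by (auto simp: B0_def sample_space_def space_pair_measure)
        with sets_Pair1[OF B0, of X] show ?thesis by simp
      qed
      \<comment> \<open>Data under \<open>\<beta>(j := a)\<close> with noise \<xi> equal data under
        \<beta> with the shifted noise, so a miss means that the shifted noise avoids the section of
        \<open>B0\<close>.\<close>
      have "{\<xi> \<in> space ?G. (\<lambda>i\<in>{..<n}. \<xi> i + a / \<sigma> * col X i) \<notin> {\<xi> \<in> space ?G. (X, \<xi>) \<in> B0}}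
          = {\<xi> \<in> space ?G. (X, \<xi>) \<in> B1}"
      proof (rule Collect_cong, rule conj_cong[OF refl])
        fix \<xi> assume "\<xi> \<in> space ?G"
        then have "(X, \<xi>) \<in> space (sample_space n p)"
          "(X, \<lambda>i\<in>{..<n}. \<xi> i + a / \<sigma> * col X i) \<in> space (sample_space n p)"
          "(\<lambda>i\<in>{..<n}. \<xi> i + a / \<sigma> * col X i) \<in> space ?G"
          using elim by (auto simp: sample_space_def space_pair_measure)
        then show "(\<lambda>i\<in>{..<n}. \<xi> i + a / \<sigma> * col X i) \<notin> {\<xi> \<in> space ?G. (X, \<xi>) \<in> B0}
            \<longleftrightarrow> (X, \<xi>) \<in> B1"
          unfolding B0_def B1_def mem_Collect_eq observe_fun_upd[of \<sigma> j p \<beta>, OF \<sigma> j \<beta>]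
          unfolding col_def[symmetric] by blast
      qed
      then show ?case
        using two_point_bound_fixed_design[OF a \<sigma> s u A] by (simp only: h_def)
    qed
  qed (use psi_design m0 m1 in auto)
  also have "\<dots> = real (p - s) * measure (sample_space n p) B0 + real s * measure (sample_space n p) B1"
    unfolding sample_space_def m0(2) m1(2) using m0(1) m1(1) by simp
  finally show ?thesis unfolding psi_design(2) B0_def B1_def .
qed

section \<open>Random supports with independent inclusions, and their tail\<close>

definition bern_weight :: "real \<Rightarrow> 'a set \<Rightarrow> 'a set \<Rightarrow> real" where
  "bern_weight q A S = (\<Prod>i\<in>S. q) * (\<Prod>i\<in>A - S. 1 - q)"

lemma bern_weight_nonneg: "0 \<le> q \<Longrightarrow> q \<le> 1 \<Longrightarrow> 0 \<le> bern_weight q A S"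
  unfolding bern_weight_def by (intro mult_nonneg_nonneg prod_nonneg) auto

text \<open>Expanding the product over A of q z + (1 - q) gives one term per support. Writing
  \<open>bern_weight\<close> with products of constants makes this expansion directly
  applicable.\<close>

lemma bern_weight_pgf:
  assumes "finite A"
  shows "(\<Sum>S\<in>Pow A. bern_weight q A S * z ^ card S) = (1 - q + q * z) ^ card A"
proof -
  have "(\<Sum>S\<in>Pow A. bern_weight q A S * z ^ card S)
      = (\<Sum>S\<in>Pow A. (\<Prod>i\<in>S. q * z) * (\<Prod>i\<in>A - S. 1 - q))"
    by (simp add: bern_weight_def power_mult_distrib mult_ac)
  also have "\<dots> = (\<Prod>i\<in>A. q * z + (1 - q))" by (rule prod_add[symmetric, OF assms])
  finally show ?thesis by (simp add: add.commute)
qed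

lemma sum_bern_weight: "finite A \<Longrightarrow> (\<Sum>S\<in>Pow A. bern_weight q A S) = 1"
  using bern_weight_pgf[of A q 1] by simp

text \<open>Conditions on whether j belongs to the support: the rest follows the same law on A -
  {j}, and j enters independently with probability q. This isolates a two-point problem in each
  coordinate.\<close>

lemma sum_bern_weight_remove:
  assumes "finite A" "j \<in> A"
  shows "(\<Sum>S\<in>Pow A. bern_weight q A S * f S)
    = (\<Sum>S\<in>Pow (A - {j}). bern_weight q (A - {j}) S * ((1 - q) * f S + q * f (insert j S)))"
proof -
  define B where "B = A - {j}"
  have B: "A = insert j B" "j \<notin> B" "finite B" using assms by (auto simp: B_def)
  have w: "bern_weight q A S = bern_weight q B S * (1 - q)"
      "bern_weight q A (insert j S) = bern_weight q B S * q" if "S \<in> Pow B" for S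
  proof -
    have "insert j B - S = insert j (B - S)" "insert j B - insert j S = B - S" "finite S" "j \<notin> S"
      using that B by (auto intro: finite_subset)
    then show "bern_weight q A S = bern_weight q B S * (1 - q)"
      "bern_weight q A (insert j S) = bern_weight q B S * q"
      using B by (simp_all add: bern_weight_def)
  qed
  have inj: "inj_on (insert j) (Pow B)" using B by (auto simp: inj_on_def)
  have "(\<Sum>S\<in>Pow A. bern_weight q A S * f S)
      = (\<Sum>S\<in>Pow B. bern_weight q A S * f S) + (\<Sum>S\<in>insert j ` Pow B. bern_weight q A S * f S)"
    unfolding B(1) Pow_insert using B by (intro sum.union_disjoint) auto
  also have "(\<Sum>S\<in>insert j ` Pow B. bern_weight q A S * f S)
      = (\<Sum>S\<in>Pow B. bern_weight q A (insert j S) * f (insert j S))"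
    by (simp add: sum.reindex[OF inj])
  finally show ?thesis
    unfolding B_def[symmetric] by (simp add: w sum.distrib[symmetric] algebra_simps)
qed

text \<open>The z-derivative of the generating function. It is obtained without differentiation:
  card S is written as a sum of membership indicators, and each is handled by conditioning on
  j.\<close>

lemma bern_weight_pgf_deriv:
  assumes "finite A"
  shows "(\<Sum>S\<in>Pow A. bern_weight q A S * (real (card S) * z ^ (card S - 1)))
    = real (card A) * q * (1 - q + q * z) ^ (card A - 1)"
proof -
  have "bern_weight q A S * (real (card S) * z ^ (card S - 1))
      = (\<Sum>j\<in>A. bern_weight q A S * (of_bool (j \<in> S) * z ^ (card S - 1)))" if "S \<in> Pow A" for S
  proof -
    have "real (card S) = (\<Sum>j\<in>A. of_bool (j \<in> S))"
      using that assms by (simp add: Int_absorb1 flip: Int_def)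
    then show ?thesis by (simp add: sum_distrib_left sum_distrib_right)
  qed
  then have "(\<Sum>S\<in>Pow A. bern_weight q A S * (real (card S) * z ^ (card S - 1)))
      = (\<Sum>S\<in>Pow A. \<Sum>j\<in>A. bern_weight q A S * (of_bool (j \<in> S) * z ^ (card S - 1)))"
    by (rule sum.cong[OF refl])
  also have "\<dots> = (\<Sum>j\<in>A. \<Sum>S\<in>Pow A. bern_weight q A S * (of_bool (j \<in> S) * z ^ (card S - 1)))"
    by (rule sum.swap)
  also have "\<dots> = (\<Sum>j\<in>A. q * (1 - q + q * z) ^ (card A - 1))"
  proof (rule sum.cong[OF refl])
    fix j assume j: "j \<in> A"
    have "(\<Sum>S\<in>Pow A. bern_weight q A S * (of_bool (j \<in> S) * z ^ (card S - 1)))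
        = (\<Sum>S\<in>Pow (A - {j}). q * (bern_weight q (A - {j}) S * z ^ card S))"
      unfolding sum_bern_weight_remove[OF assms j]
    proof (rule sum.cong[OF refl])
      fix S assume "S \<in> Pow (A - {j})"
      then have "finite S" "j \<notin> S" using assms by (auto intro: finite_subset)
      \<comment> \<open>The term without j vanishes; in the term with j the exponent card - 1 is
        exactly the size of S.\<close>
      then show "bern_weight q (A - {j}) S * ((1 - q) * (of_bool (j \<in> S) * z ^ (card S - 1))
          + q * (of_bool (j \<in> insert j S) * z ^ (card (insert j S) - 1)))
          = q * (bern_weight q (A - {j}) S * z ^ card S)"
        by simp
    qed
    also have "\<dots> = q * (1 - q + q * z) ^ (card A - 1)"
      using assms j by (simp add: bern_weight_pgf flip: sum_distrib_left)
    finally show "(\<Sum>S\<in>Pow A. bern_weight q A S * (of_bool (j \<in> S) * z ^ (card S - 1)))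
        = q * (1 - q + q * z) ^ (card A - 1)" .
  qed
  finally show ?thesis by simp
qed

text \<open>The function -ln (1 - t) - t - t^2 / 2 vanishes at 0 and has derivative t^2 / (1 - t)
  \<ge> 0.\<close>

lemma ln_one_minus_upper_bound_quadratic:
  fixes x :: real
  assumes "0 \<le> x" "x < 1"
  shows "ln (1 - x) \<le> - x - x\<^sup>2 / 2"
proof -
  have "- ln (1 - 0) - 0 - 0\<^sup>2 / 2 \<le> - ln (1 - x) - x - x\<^sup>2 / (2::real)"
  proof (rule DERIV_nonneg_imp_nondecreasing[OF assms(1)])
    fix t assume "0 \<le> t" "t \<le> x"
    with assms have t: "0 \<le> t" "t < 1" by auto
    have "((\<lambda>t. - ln (1 - t) - t - t\<^sup>2 / 2) has_real_derivative (t\<^sup>2 / (1 - t))) (at t)"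
      using t by (auto intro!: derivative_eq_intros simp: field_simps power2_eq_square)
    with t show "\<exists>y. ((\<lambda>t. - ln (1 - t) - t - t\<^sup>2 / 2) has_real_derivative y) (at t) \<and> 0 \<le> y"
      by (intro exI[of _ "t\<^sup>2 / (1 - t)"]) auto
  qed
  then show ?thesis by simp
qed

text \<open>Chernoff bound for the expected size N of the support on N > s. There N - 1 \<ge> s, so
  N \<le> N z^(N-1) / z^s for z \<ge> 1, and the derivative of the generating function supplies the
  factor m together with the tilted expectation.\<close>

lemma bern_weight_tail:
  fixes s :: nat
  assumes A: "finite A" and q: "0 \<le> q" "q \<le> 1"
    and m: "m = q * real (card A)" "0 < m" "m \<le> real s"
  shows "(\<Sum>S | S \<in> Pow A \<and> s < card S. bern_weight q A S * real (card S))
    \<le> m * exp (- (real s - m)\<^sup>2 / (2 * real s))"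
proof -
  \<comment> \<open>This tilt minimises exp (m (z - 1)) / z^s.\<close>
  define z where "z = real s / m"
  have z: "z \<ge> 1" using m by (simp add: z_def)
  have s: "real s > 0" using m by linarith
  have "(\<Sum>S | S \<in> Pow A \<and> s < card S. bern_weight q A S * real (card S))
      \<le> (\<Sum>S | S \<in> Pow A \<and> s < card S. bern_weight q A S * (real (card S) * z ^ (card S - 1)) / z ^ s)"
  proof (rule sum_mono)
    fix S assume "S \<in> {S \<in> Pow A. s < card S}"
    then have "z ^ s \<le> z ^ (card S - 1)" using z by (intro power_increasing) auto
    then have "1 \<le> z ^ (card S - 1) / z ^ s" using z by simp
    then have "bern_weight q A S * real (card S) * 1
        \<le> bern_weight q A S * real (card S) * (z ^ (card S - 1) / z ^ s)"
      using bern_weight_nonneg[OF q] by (intro mult_left_mono mult_nonneg_nonneg) auto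
    then show "bern_weight q A S * real (card S)
        \<le> bern_weight q A S * (real (card S) * z ^ (card S - 1)) / z ^ s" by simp
  qed
  also have "\<dots> \<le> (\<Sum>S\<in>Pow A. bern_weight q A S * (real (card S) * z ^ (card S - 1)) / z ^ s)"
    using A z bern_weight_nonneg[OF q]
    by (intro sum_mono2) (auto intro!: divide_nonneg_nonneg mult_nonneg_nonneg)
  also have "\<dots> = m * ((1 + q * (z - 1)) ^ (card A - 1) / z ^ s)"
    unfolding sum_divide_distrib[symmetric] bern_weight_pgf_deriv[OF A]
    by (simp add: m algebra_simps)
  \<comment> \<open>Raising the exponent to card A is harmless as the base is at least 1, and it
    makes q * card A = m appear after 1 + y \<le> exp y.\<close>
  also have "(1 + q * (z - 1)) ^ (card A - 1) \<le> exp (real s - m)"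
  proof -
    have "(1 + q * (z - 1)) ^ (card A - 1) \<le> (1 + q * (z - 1)) ^ card A"
      using z q by (intro power_increasing) auto
    also have "\<dots> \<le> exp (q * (z - 1)) ^ card A"
      using z q by (intro power_mono exp_ge_add_one_self) auto
    also have "\<dots> = exp (m * (z - 1))"
      by (simp add: m mult_ac flip: exp_of_nat_mult)
    also have "m * (z - 1) = real s - m" using m(2) by (simp add: z_def field_simps)
    finally show ?thesis .
  qed
  also have "exp (real s - m) / z ^ s \<le> exp (- (real s - m)\<^sup>2 / (2 * real s))"
  proof -
    \<comment> \<open>With x = 1 - m / s one has ln z = -ln (1 - x). The linear term s x cancels s -
      m in the exponent, and the quadratic term leaves (s - m)^2 / (2 s).\<close>
    define x where "x = 1 - m / real s"
    have x: "0 \<le> x" "x < 1" using m s by (auto simp: x_def)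
    have "ln z = - ln (1 - x)" using m s by (simp add: z_def x_def ln_div)
    with ln_one_minus_upper_bound_quadratic[OF x] have "ln z \<ge> x + x\<^sup>2 / 2" by simp
    then have "real s * ln z \<ge> real s * (x + x\<^sup>2 / 2)" by (intro mult_left_mono) auto
    also have "real s * (x + x\<^sup>2 / 2) = (real s - m) + (real s - m)\<^sup>2 / (2 * real s)"
      using s by (simp add: x_def field_simps power2_eq_square)
    finally have "real s - m - real s * ln z \<le> - (real s - m)\<^sup>2 / (2 * real s)" by simp
    moreover have "z ^ s = exp (real s * ln z)" using z by (simp add: exp_of_nat_mult)
    ultimately show ?thesis by (simp flip: exp_diff)
  qed
  finally show ?thesis using m z by (simp add: divide_right_mono mult_left_mono)
qed

section \<open>Selectors, Hamming risk and truncation\<close>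

lemma selectors_component_measurable:
  assumes "\<eta> \<in> selectors n p" "j < p"
  shows "Measurable.pred (data_space n p) (\<lambda>x. \<eta> x j)"
  using measurable_compose[OF assms(1)[unfolded selectors_def]
      measurable_component_singleton[of j "{..<p}"]] assms(2) by simp

lemma real_hamming:
  "real (hamming p e \<beta>) = (\<Sum>j<p. of_bool (e j \<noteq> (\<beta> j \<noteq> 0)))"
  unfolding hamming_def by (simp add: Int_def)

lemma hamming_le: "hamming p e \<beta> \<le> p"
  unfolding hamming_def using card_mono[of "{..<p}"] by (metis (no_types, lifting) card_lessThan finite_lessThan mem_Collect_eq subsetI)

lemma integrable_hamming:
  assumes "\<eta> \<in> selectors n p"
  shows "integrable (sample_space n p) (\<lambda>\<omega>. real (hamming p (\<eta> (observe n p \<sigma> \<beta> \<omega>)) \<beta>))"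
proof -
  interpret prob_space "sample_space n p" by (rule prob_space_sample_space)
  note [measurable] = selectors_component_measurable[OF assms]
  show ?thesis
  proof (rule integrable_const_bound[where B = "real p"])
    show "(\<lambda>\<omega>. real (hamming p (\<eta> (observe n p \<sigma> \<beta> \<omega>)) \<beta>)) \<in> borel_measurable (sample_space n p)"
      unfolding real_hamming by measurable
  qed (simp add: hamming_le)
qed

text \<open>Linearity over coordinates, which lets the Bayes risk be bounded by one test per
  coordinate.\<close>

lemma risk_eq_sum:
  assumes "\<eta> \<in> selectors n p"
  shows "risk n p \<sigma> \<eta> \<beta> = (\<Sum>j<p. measure (sample_space n p)
    {\<omega> \<in> space (sample_space n p). \<eta> (observe n p \<sigma> \<beta> \<omega>) j \<noteq> (\<beta> j \<noteq> 0)})"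
proof -
  interpret prob_space "sample_space n p" by (rule prob_space_sample_space)
  note [measurable] = selectors_component_measurable[OF assms]
  define E where "E j = {\<omega> \<in> space (sample_space n p). \<eta> (observe n p \<sigma> \<beta> \<omega>) j \<noteq> (\<beta> j \<noteq> 0)}" for j
  have E: "E j \<in> sets (sample_space n p)" if "j < p" for j
    unfolding E_def using that by measurable
  have "risk n p \<sigma> \<eta> \<beta> = (\<integral>\<omega>. (\<Sum>j<p. indicator (E j) \<omega>) \<partial>sample_space n p)"
    unfolding risk_def real_hamming
    by (intro Bochner_Integration.integral_cong sum.cong) (auto simp: E_def indicator_def)
  also have "\<dots> = (\<Sum>j<p. \<integral>\<omega>. indicator (E j) \<omega> \<partial>sample_space n p)"
    using E by (intro Bochner_Integration.integral_sum integrable_real_indicator)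
      (auto simp: emeasure_eq_measure)
  also have "\<dots> = (\<Sum>j<p. measure (sample_space n p) (E j))"
    using E by (intro sum.cong) (auto simp: sets.Int_space_eq2)
  finally show ?thesis unfolding E_def .
qed

lemma risk_mono:
  assumes "\<eta> \<in> selectors n p" "\<eta>' \<in> selectors n p"
    and "\<And>x. hamming p (\<eta> x) \<beta> \<le> hamming p (\<eta>' x) \<beta>"
  shows "risk n p \<sigma> \<eta> \<beta> \<le> risk n p \<sigma> \<eta>' \<beta>"
  unfolding risk_def using assms by (intro integral_mono integrable_hamming) auto

lemma risk_nonneg: "0 \<le> risk n p \<sigma> \<eta> \<beta>"
  unfolding risk_def by simp

lemma risk_bounded:
  assumes "\<eta> \<in> selectors n p" "\<And>x. hamming p (\<eta> x) \<beta> \<le> k"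
  shows "risk n p \<sigma> \<eta> \<beta> \<le> real k"
proof -
  interpret prob_space "sample_space n p" by (rule prob_space_sample_space)
  have "risk n p \<sigma> \<eta> \<beta> \<le> (\<integral>\<omega>. real k \<partial>sample_space n p)"
    unfolding risk_def using assms by (intro integral_mono integrable_hamming) auto
  then show ?thesis by (simp add: prob_space)
qed

text \<open>Caps the loss on vectors with more than s nonzero entries. The zero vector is restricted
  to \<open>{..<p}\<close> because values of a selector must be extensional.\<close>

definition trunc_selector :: "nat \<Rightarrow> nat \<Rightarrow> ('a \<Rightarrow> nat \<Rightarrow> bool) \<Rightarrow> 'a \<Rightarrow> nat \<Rightarrow> bool" where
  "trunc_selector p k \<eta> x = (if card {i\<in>{..<p}. \<eta> x i} \<le> k then \<eta> x else (\<lambda>i\<in>{..<p}. False))"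

lemma trunc_selector_in_selectors:
  assumes "\<eta> \<in> selectors n p"
  shows "trunc_selector p k \<eta> \<in> selectors n p"
proof -
  note [measurable] = selectors_component_measurable[OF assms]
  \<comment> \<open>The cardinality condition is first stated as a real sum of indicators, whose
    measurability is immediate.\<close>
  have "Measurable.pred (data_space n p) (\<lambda>x. (\<Sum>i<p. of_bool (\<eta> x i)) \<le> real k)"
    by measurable
  moreover have "(\<Sum>i<p. of_bool (\<eta> x i)) \<le> real k \<longleftrightarrow> card {i\<in>{..<p}. \<eta> x i} \<le> k" for x
    by (simp add: Int_def)
  ultimately have "Measurable.pred (data_space n p) (\<lambda>x. card {i\<in>{..<p}. \<eta> x i} \<le> k)" by simp
  then show ?thesis
    using assms unfolding selectors_def trunc_selector_def
    by (intro measurable_If) (auto intro!: measurable_const simp: space_PiM)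
qed

text \<open>A selection of more than 2s coordinates has more than s of them off an s-sparse support,
  while the zero vector errs only on the support, hence at most s times.\<close>

lemma hamming_trunc_selector_mono:
  assumes "card {i\<in>{..<p}. \<beta> i \<noteq> 0} \<le> s"
  shows "hamming p (trunc_selector p (2 * s) \<eta> x) \<beta> \<le> hamming p (\<eta> x) \<beta>"
proof (cases "card {i\<in>{..<p}. \<eta> x i} \<le> 2 * s")
  case False
  let ?S = "{i\<in>{..<p}. \<beta> i \<noteq> 0}" and ?E = "{i\<in>{..<p}. \<eta> x i}"
  have "hamming p (trunc_selector p (2 * s) \<eta> x) \<beta> = card ?S"
    unfolding hamming_def trunc_selector_def using False by (auto intro!: arg_cong[where f = card])
  also have "\<dots> \<le> card ?E - card ?S" using False assms by simp
  also have "\<dots> \<le> card (?E - ?S)" by (rule diff_card_le_card_Diff) simp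
  also have "\<dots> \<le> hamming p (\<eta> x) \<beta>"
    unfolding hamming_def by (intro card_mono) auto
  finally show ?thesis .
qed (simp add: trunc_selector_def)

text \<open>Every error lies either in the selected set or in the support.\<close>

lemma hamming_trunc_selector_le:
  "hamming p (trunc_selector p k \<eta> x) \<beta> \<le> k + card {i\<in>{..<p}. \<beta> i \<noteq> 0}"
proof -
  let ?E = "{i\<in>{..<p}. trunc_selector p k \<eta> x i}"
  have "hamming p (trunc_selector p k \<eta> x) \<beta> \<le> card (?E \<union> {i\<in>{..<p}. \<beta> i \<noteq> 0})"
    unfolding hamming_def by (intro card_mono) auto
  also have "\<dots> \<le> card ?E + card {i\<in>{..<p}. \<beta> i \<noteq> 0}" by (rule card_Un_le)
  also have "card ?E \<le> k" by (simp add: trunc_selector_def)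
  finally show ?thesis by simp
qed

section \<open>From the Bayes risk to the minimax lower bound\<close>

lemma bayes_risk_bound:
  assumes "a > 0" "\<sigma> > 0" "n \<ge> 1" "s \<ge> 1" "s < p" "0 < s'" "s' \<le> real s"
    and \<eta>: "\<eta> \<in> selectors n p"
  shows "s' / real s * psi_plus n p s a \<sigma>
    \<le> (\<Sum>S\<in>Pow {..<p}. bern_weight (s' / real p) {..<p} S * risk n p \<sigma> \<eta> (\<lambda>i. if i \<in> S then a else 0))"
proof -
  define q where "q = s' / real p"
  define b where "b S = (\<lambda>i::nat. if i \<in> S then a else 0)" for S
  define err where "err j S = measure (sample_space n p)
    {\<omega> \<in> space (sample_space n p). \<eta> (observe n p \<sigma> (b S) \<omega>) j \<noteq> (b S j \<noteq> 0)}" for j S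
  have q: "0 < q" "q \<le> 1" using assms by (simp_all add: q_def)
  \<comment> \<open>Each of the p coordinates carries an equal share of the bound, by conditioning
    on the part of the support outside j.\<close>
  have coord: "s' / real s * (psi_plus n p s a \<sigma> / real p)
      \<le> (\<Sum>S\<in>Pow {..<p}. bern_weight q {..<p} S * err j S)" if j: "j < p" for j
  proof -
    have two: "s' / real s * (psi_plus n p s a \<sigma> / real p) \<le> (1 - q) * err j S + q * err j (insert j S)"
      if S: "S \<in> Pow ({..<p} - {j})" for S
    proof -
      have bj: "b S j = 0" and bi: "b (insert j S) = (b S)(j := a)"
        using S by (auto simp: b_def fun_eq_iff)
      have "psi_plus n p s a \<sigma> \<le> real (p - s) * err j S + real s * err j (insert j S)"
        using two_point_bound[where j = j and \<beta> = "b S" and Q = "\<lambda>x. \<eta> x j", OF assms(1,2) _ assms(5,3) j bj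
            selectors_component_measurable[OF \<eta> j]] assms
        by (simp add: err_def bi bj)
      then have "s' / (real s * real p) * psi_plus n p s a \<sigma>
          \<le> s' / (real s * real p) * (real (p - s) * err j S + real s * err j (insert j S))"
        using assms by (intro mult_left_mono) auto
      \<comment> \<open>The scaling s' / (s p) turns the weight s into q and the weight p - s into
        s' / s - q, which is at most 1 - q because s' \<le> s.\<close>
      also have "\<dots> = (s' / real s - q) * err j S + q * err j (insert j S)"
        using assms by (simp add: q_def field_simps of_nat_diff)
      also have "\<dots> \<le> (1 - q) * err j S + q * err j (insert j S)"
        using assms by (intro add_right_mono mult_right_mono) (auto simp: err_def)
      finally show ?thesis by simp
    qed
    have "s' / real s * (psi_plus n p s a \<sigma> / real p)
        = (\<Sum>S\<in>Pow ({..<p} - {j}). bern_weight q ({..<p} - {j}) S * (s' / real s * (psi_plus n p s a \<sigma> / real p)))"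
      unfolding sum_distrib_right[symmetric] by (simp add: sum_bern_weight)
    also have "\<dots> \<le> (\<Sum>S\<in>Pow ({..<p} - {j}). bern_weight q ({..<p} - {j}) S * ((1 - q) * err j S + q * err j (insert j S)))"
      using q by (intro sum_mono mult_left_mono two bern_weight_nonneg) auto
    also have "\<dots> = (\<Sum>S\<in>Pow {..<p}. bern_weight q {..<p} S * err j S)"
      using j by (intro sum_bern_weight_remove[symmetric]) auto
    finally show ?thesis .
  qed
  have "s' / real s * psi_plus n p s a \<sigma> = (\<Sum>j<p. s' / real s * (psi_plus n p s a \<sigma> / real p))"
    using assms by simp
  also have "\<dots> \<le> (\<Sum>j<p. \<Sum>S\<in>Pow {..<p}. bern_weight q {..<p} S * err j S)"
    by (intro sum_mono coord) auto
  also have "\<dots> = (\<Sum>S\<in>Pow {..<p}. bern_weight q {..<p} S * (\<Sum>j<p. err j S))"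
    by (subst sum.swap) (simp add: sum_distrib_left)
  also have "\<dots> = (\<Sum>S\<in>Pow {..<p}. bern_weight q {..<p} S * risk n p \<sigma> \<eta> (b S))"
    by (simp add: risk_eq_sum[OF \<eta>] err_def)
  finally show ?thesis unfolding q_def b_def .
qed

theorem theorem1:
  fixes n p s :: nat and a \<sigma> s' :: real
  assumes "a > 0" and "\<sigma> > 0" and "n \<ge> 1" and "p \<ge> 1" and "s \<ge> 1" and "s < p"
    and "0 < s'" and "s' \<le> real s"
  shows "(INF \<eta>\<in>selectors n p. SUP \<beta>\<in>Omega p s a. risk n p \<sigma> \<eta> \<beta>)
           \<ge> s' / real s * (psi_plus n p s a \<sigma>
                 - 4 * real s * exp (- (real s - s')\<^sup>2 / (2 * real s)))"
proof (rule cINF_greatest)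
  \<comment> \<open>A lower bound for a real infimum needs a nonempty index set; the constant zero
    selector provides an element.\<close>
  have "(\<lambda>_. \<lambda>i\<in>{..<p}. False) \<in> selectors n p"
    unfolding selectors_def by (intro measurable_const) (simp add: space_PiM)
  then show "selectors n p \<noteq> {}" by blast
next
  fix \<eta> assume \<eta>: "\<eta> \<in> selectors n p"
  define K where "K = (SUP \<beta>\<in>Omega p s a. risk n p \<sigma> \<eta> \<beta>)"
  define T where "T = trunc_selector p (2 * s) \<eta>"
  define b where "b S = (\<lambda>i::nat. if i \<in> S then a else 0)" for S
  define w where "w = bern_weight (s' / real p) {..<p}"
  have T: "T \<in> selectors n p" unfolding T_def by (rule trunc_selector_in_selectors[OF \<eta>])
  have q: "0 \<le> s' / real p" "s' / real p \<le> 1" using assms by simp_all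
  have w_nonneg: "0 \<le> w S" for S unfolding w_def by (rule bern_weight_nonneg[OF q])
  have w_sum: "(\<Sum>S\<in>Pow {..<p}. w S) = 1" unfolding w_def by (rule sum_bern_weight) simp
  \<comment> \<open>The real supremum dominates its members because the Hamming loss, hence the
    risk, is bounded by p.\<close>
  have K: "risk n p \<sigma> \<eta> \<beta> \<le> K" if "\<beta> \<in> Omega p s a" for \<beta>
    unfolding K_def using that
    by (intro cSUP_upper bdd_aboveI2[where M = "real p"] risk_bounded[OF \<eta>] hamming_le)
  \<comment> \<open>Nonnegativity of K is what permits enlarging the sum over small supports to all
    supports below.\<close>
  have "(\<lambda>_. 0) \<in> Omega p s a" by (simp add: Omega_def)
  from order_trans[OF risk_nonneg K[OF this]] have "0 \<le> K" .
  have supp: "{i \<in> {..<p}. b S i \<noteq> 0} = S" if "S \<in> Pow {..<p}" for S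
    using that assms(1) by (auto simp: b_def)
  let ?small = "{S \<in> Pow {..<p}. \<not> s < card S}" and ?large = "{S \<in> Pow {..<p}. s < card S}"
  have small: "risk n p \<sigma> T (b S) \<le> K" if S: "S \<in> ?small" for S
  proof -
    have "b S \<in> Omega p s a"
      using S supp[of S] assms(1) by (auto simp: Omega_def) (auto simp: b_def split: if_splits)
    moreover have "risk n p \<sigma> T (b S) \<le> risk n p \<sigma> \<eta> (b S)"
      using S supp[of S] by (intro risk_mono[OF T \<eta>]) (simp add: T_def hamming_trunc_selector_mono)
    ultimately show ?thesis using K by fastforce
  qed
  \<comment> \<open>Here s < card S, so the loss bound 2s + card S is at most three times card
    S.\<close>
  have large: "risk n p \<sigma> T (b S) \<le> 3 * real (card S)" if S: "S \<in> ?large" for S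
  proof -
    have "risk n p \<sigma> T (b S) \<le> real (2 * s + card S)"
      using hamming_trunc_selector_le[of p "2 * s" \<eta> _ "b S"] supp[of S] S
      by (intro risk_bounded[OF T]) (simp add: T_def)
    then show ?thesis using S by simp
  qed
  have "s' / real s * psi_plus n p s a \<sigma> \<le> (\<Sum>S\<in>Pow {..<p}. w S * risk n p \<sigma> T (b S))"
    unfolding w_def b_def using assms T by (intro bayes_risk_bound) auto
  also have "\<dots> = (\<Sum>S\<in>?small. w S * risk n p \<sigma> T (b S)) + (\<Sum>S\<in>?large. w S * risk n p \<sigma> T (b S))"
    by (subst sum.union_disjoint[symmetric]) (auto intro!: sum.cong)
  also have "(\<Sum>S\<in>?small. w S * risk n p \<sigma> T (b S)) \<le> (\<Sum>S\<in>Pow {..<p}. w S * K)"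
  proof -
    have "(\<Sum>S\<in>?small. w S * risk n p \<sigma> T (b S)) \<le> (\<Sum>S\<in>?small. w S * K)"
      by (intro sum_mono mult_left_mono small w_nonneg) auto
    also have "\<dots> \<le> (\<Sum>S\<in>Pow {..<p}. w S * K)"
      using w_nonneg \<open>0 \<le> K\<close> by (intro sum_mono2) auto
    finally show ?thesis .
  qed
  also have "(\<Sum>S\<in>Pow {..<p}. w S * K) = K" by (simp add: w_sum flip: sum_distrib_right)
  also have "(\<Sum>S\<in>?large. w S * risk n p \<sigma> T (b S)) \<le> 3 * (\<Sum>S\<in>?large. w S * real (card S))"
  proof -
    have "(\<Sum>S\<in>?large. w S * risk n p \<sigma> T (b S)) \<le> (\<Sum>S\<in>?large. w S * (3 * real (card S)))"
      by (intro sum_mono mult_left_mono large w_nonneg) auto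
    then show ?thesis by (simp add: sum_distrib_left mult_ac)
  qed
  also have "(\<Sum>S\<in>?large. w S * real (card S)) \<le> s' * exp (- (real s - s')\<^sup>2 / (2 * real s))"
    unfolding w_def using assms q by (intro bern_weight_tail) auto
  \<comment> \<open>The Bayes mean m in the tail bound is q p = s'. The remainder 3 s' exp (...)
    lies below the 4 s' exp (...) that results from multiplying out the claim.\<close>
  finally have "s' / real s * psi_plus n p s a \<sigma>
      \<le> K + 3 * (s' * exp (- (real s - s')\<^sup>2 / (2 * real s)))" by simp
  moreover have "s' / real s * (4 * real s * exp (- (real s - s')\<^sup>2 / (2 * real s)))
      = 4 * (s' * exp (- (real s - s')\<^sup>2 / (2 * real s)))" using assms by simp
  moreover have "0 \<le> s' * exp (- (real s - s')\<^sup>2 / (2 * real s))" using assms by simp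
  ultimately show "s' / real s * (psi_plus n p s a \<sigma>
      - 4 * real s * exp (- (real s - s')\<^sup>2 / (2 * real s))) \<le> (SUP \<beta>\<in>Omega p s a. risk n p \<sigma> \<eta> \<beta>)"
    unfolding K_def[symmetric] right_diff_distrib by linarith
qed

end
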